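(* Every fine diffeological vector space is projective.
   Context: A diffeological space is a set $X$ together with a specified set of functions $U\to X$ (called plots), for every open set $U\subseteq\mathbb{R}^n$ and every $n\in\mathbb{N}=\{0,1,2,\dots\}$, such that: (1) every constant map $U\to X$ is a plot; (2) if $U\to X$ is a plot and $V\to U$ is a smooth map between open subsets of Euclidean spaces, then $V\to U\to X$ is a plot; (3) if $U=\bigcup_i U_i$ is an open cover and $U\to X$ is a map whose restrictions to all $U_i$ are plots, then $U\to X$ is a plot. A map between diffeological spaces is smooth if composing with it sends plots to plots. Products carry the product diffeology, and $\mathbb{R}$ carries the standard diffeology. A diffeological vector space is a real vector space $V$ with a diffeology such that addition $V\times V\to V$ and scalar multiplication $\mathbb{R}\times V\to V$ are smooth. The fine diffeology on a real vector space $V$ is the smallest diffeology making $V$ a diffeological vector space; it is the diffeology generated by all linear maps $\mathbb{R}^n\to V$, $n\in\mathbb{N}$ (i.e. plots are the maps which locally have the form $l\circ f$ with $f$ smooth into some $\mathbb{R}^n$ and $l:\mathbb{R}^n\to V$ linear). A fine diffeological vector space is a vector space with the fine diffeology. A linear subduction is a smooth linear surjection $f:W_1\to W_2$ of diffeological vector spaces such that every plot of $W_2$ locally (near each point of its domain) lifts along $f$ to a plot of $W_1$. A diffeological vector space $V$ is projective if for every linear subduction $f:W_1\to W_2$ and every smooth linear map $g:V\to W_2$ there exists a smooth linear map $h:V\to W_1$ with $g=f\circ h$. *)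

theory Defs
  imports "HOL-Analysis.Analysis"
begin

section \<open>Smooth maps between open subsets of Euclidean spaces\<close>

text \<open>
  The dimension has to vary inside the notion of a diffeology, so \<open>\<real>\<^sup>n\<close> is the topological space
  \<^term>\<open>Euclidean_space n\<close>, whose points are the \<open>x :: nat \<Rightarrow> real\<close> with \<open>x i = 0\<close> for all \<open>i \<ge> n\<close>.
  A real function on an open \<open>U \<subseteq> \<real>\<^sup>n\<close> is of class \<open>C\<^sup>k\<close> iff all its iterated partial
  derivatives up to order \<open>k\<close> exist and are continuous on \<open>U\<close>. The values of the function outside
  \<open>U\<close> are irrelevant.
\<close>

primrec Ck_on :: "nat \<Rightarrow> nat \<Rightarrow> (nat \<Rightarrow> real) set \<Rightarrow> ((nat \<Rightarrow> real) \<Rightarrow> real) \<Rightarrow> bool" where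
  "Ck_on 0 n U f \<longleftrightarrow> continuous_map (subtopology (Euclidean_space n) U) euclideanreal f"
| "Ck_on (Suc k) n U f \<longleftrightarrow>
     continuous_map (subtopology (Euclidean_space n) U) euclideanreal f \<and>
     (\<forall>i<n. \<exists>g. (\<forall>x\<in>U. ((\<lambda>t. f (x(i := t))) has_real_derivative g x) (at (x i))) \<and> Ck_on k n U g)"

definition smooth_real_on :: "nat \<Rightarrow> (nat \<Rightarrow> real) set \<Rightarrow> ((nat \<Rightarrow> real) \<Rightarrow> real) \<Rightarrow> bool" where
  "smooth_real_on n U f \<longleftrightarrow> (\<forall>k. Ck_on k n U f)"

definition smooth_euclidean_map ::
    "nat \<Rightarrow> (nat \<Rightarrow> real) set \<Rightarrow> nat \<Rightarrow> (nat \<Rightarrow> real) set \<Rightarrow> ((nat \<Rightarrow> real) \<Rightarrow> nat \<Rightarrow> real) \<Rightarrow> bool" where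
  "smooth_euclidean_map m V n U \<phi> \<longleftrightarrow>
     openin (Euclidean_space m) V \<and> openin (Euclidean_space n) U \<and> \<phi> ` V \<subseteq> U \<and>
     (\<forall>i<n. smooth_real_on m V (\<lambda>x. \<phi> x i))"


section \<open>Diffeological spaces\<close>

text \<open>
  A diffeology \<open>D\<close> on the type \<open>'a\<close> assigns to \<open>n\<close> and \<open>U\<close> the set \<open>D n U\<close> of plots \<open>U \<rightarrow> 'a\<close> with
  \<open>U\<close> open in \<open>\<real>\<^sup>n\<close>. A map with domain \<open>U\<close> is represented by its unique representative in
  \<^term>\<open>extensional U\<close>.
\<close>

type_synonym 'a plots = "nat \<Rightarrow> (nat \<Rightarrow> real) set \<Rightarrow> ((nat \<Rightarrow> real) \<Rightarrow> 'a) set"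

locale diffeology =
  fixes D :: "'a plots"
  assumes plot_open: "p \<in> D n U \<Longrightarrow> openin (Euclidean_space n) U"
    and plot_extensional: "p \<in> D n U \<Longrightarrow> p \<in> extensional U"
    and plot_const: "openin (Euclidean_space n) U \<Longrightarrow> (\<lambda>_\<in>U. c) \<in> D n U"
    and plot_compose: "p \<in> D n U \<Longrightarrow> smooth_euclidean_map m V n U \<phi> \<Longrightarrow> compose V p \<phi> \<in> D m V"
    and plot_glue: "(\<And>U. U \<in> \<U> \<Longrightarrow> openin (Euclidean_space n) U) \<Longrightarrow> p \<in> extensional (\<Union>\<U>) \<Longrightarrow>
      (\<And>U. U \<in> \<U> \<Longrightarrow> restrict p U \<in> D n U) \<Longrightarrow> p \<in> D n (\<Union>\<U>)"

definition diff_smooth :: "'a plots \<Rightarrow> 'b plots \<Rightarrow> ('a \<Rightarrow> 'b) \<Rightarrow> bool" where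
  "diff_smooth D E f \<longleftrightarrow> (\<forall>n U. \<forall>p\<in>D n U. compose U f p \<in> E n U)"

definition product_diffeology :: "'a plots \<Rightarrow> 'b plots \<Rightarrow> ('a \<times> 'b) plots" where
  "product_diffeology D E n U =
     {p \<in> extensional U. compose U fst p \<in> D n U \<and> compose U snd p \<in> E n U}"

definition real_diffeology :: "real plots" where
  "real_diffeology n U =
     {p \<in> extensional U. openin (Euclidean_space n) U \<and> smooth_real_on n U p}"


section \<open>Diffeological vector spaces\<close>

definition diffeological_vector_space :: "'v::real_vector plots \<Rightarrow> bool" where
  "diffeological_vector_space D \<longleftrightarrow>
     diffeology D \<and>
     diff_smooth (product_diffeology D D) D (\<lambda>(x, y). x + y) \<and>
     diff_smooth (product_diffeology real_diffeology D) D (\<lambda>(a, x). a *\<^sub>R x)"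

text \<open>The smallest diffeology making the vector space \<open>'v\<close> a diffeological vector space; that it
  does make \<open>'v\<close> one is shown below.\<close>

definition fine_diffeology :: "'v::real_vector plots" where
  "fine_diffeology n U = (\<Inter>D\<in>Collect diffeological_vector_space. D n U)"

definition fine_diffeological_vector_space :: "'v::real_vector plots \<Rightarrow> bool" where
  "fine_diffeological_vector_space D \<longleftrightarrow> D = fine_diffeology"

definition linear_subduction ::
    "'a::real_vector plots \<Rightarrow> 'b::real_vector plots \<Rightarrow> ('a \<Rightarrow> 'b) \<Rightarrow> bool" where
  "linear_subduction D E f \<longleftrightarrow>
     diffeological_vector_space D \<and> diffeological_vector_space E \<and>
     linear f \<and> diff_smooth D E f \<and> surj f \<and>
     (\<forall>n U. \<forall>p\<in>E n U. \<forall>x\<in>U. \<exists>V. openin (Euclidean_space n) V \<and> x \<in> V \<and> V \<subseteq> U \<and>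
        (\<exists>q\<in>D n V. compose V f q = restrict p V))"

text \<open>
  A definition cannot quantify over types, so the types carrying \<open>W\<^sub>1\<close> and \<open>W\<^sub>2\<close> are parameters;
  projectivity is this property for all types \<open>'a\<close> and \<open>'b\<close>.
\<close>

definition projective_diffeological_vector_space ::
    "'a::real_vector itself \<Rightarrow> 'b::real_vector itself \<Rightarrow> 'v::real_vector plots \<Rightarrow> bool" where
  "projective_diffeological_vector_space _ _ D \<longleftrightarrow>
     diffeological_vector_space D \<and>
     (\<forall>(D1 :: 'a plots) (D2 :: 'b plots) f g.
        linear_subduction D1 D2 f \<and> linear g \<and> diff_smooth D D2 g \<longrightarrow>
        (\<exists>h. linear h \<and> diff_smooth D D1 h \<and> g = f \<circ> h))"


section \<open>The fine diffeology is the least vector space diffeology\<close>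

lemma fine_diffeology_least:
  "diffeological_vector_space D \<Longrightarrow> fine_diffeology n U \<subseteq> D n U"
  by (auto simp: fine_diffeology_def)

lemma openin_smooth_domain: "smooth_euclidean_map m V n U \<phi> \<Longrightarrow> openin (Euclidean_space m) V"
  by (simp add: smooth_euclidean_map_def)

lemma diffeological_vector_space_indiscrete:
  "diffeological_vector_space
     (\<lambda>n U. {p :: (nat \<Rightarrow> real) \<Rightarrow> 'v::real_vector.
       p \<in> extensional U \<and> openin (Euclidean_space n) U})"
  (is "diffeological_vector_space ?I")
proof -
  have "diffeology ?I"
    by (rule diffeology.intro)
      (simp_all add: compose_def openin_smooth_domain openin_Union)
  moreover have "diff_smooth (product_diffeology ?I ?I) ?I (\<lambda>(x, y). x + y)"
    unfolding diff_smooth_def product_diffeology_def by (simp add: compose_def)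
  moreover have "diff_smooth (product_diffeology real_diffeology ?I) ?I (\<lambda>(a, x). a *\<^sub>R x)"
    unfolding diff_smooth_def product_diffeology_def by (simp add: compose_def)
  ultimately show ?thesis
    unfolding diffeological_vector_space_def by (intro conjI)
qed

lemma diffeological_vector_space_fine:
  "diffeological_vector_space (fine_diffeology :: 'v::real_vector plots)"
proof -
  have fineI: "p \<in> fine_diffeology n U"
    if "\<And>D. diffeological_vector_space D \<Longrightarrow> p \<in> D n U" for p :: "(nat \<Rightarrow> real) \<Rightarrow> 'v" and n U
    using that by (simp add: fine_diffeology_def)
  have fineD: "p \<in> D n U" if "diffeological_vector_space D" "p \<in> fine_diffeology n U"
    for p :: "(nat \<Rightarrow> real) \<Rightarrow> 'v" and n U D
    using that fine_diffeology_least by blast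
  have diffD: "diffeology D" if "diffeological_vector_space D" for D :: "'v plots"
    using that by (simp add: diffeological_vector_space_def)
  have "diffeology (fine_diffeology :: 'v plots)"
  proof
    fix p :: "(nat \<Rightarrow> real) \<Rightarrow> 'v" and n U assume "p \<in> fine_diffeology n U"
    from fineD[OF diffeological_vector_space_indiscrete this]
    show "openin (Euclidean_space n) U" "p \<in> extensional U" by blast+
  next
    fix n U and c :: 'v assume "openin (Euclidean_space n) U"
    then show "(\<lambda>_\<in>U. c) \<in> fine_diffeology n U"
      by (intro fineI diffeology.plot_const diffD)
  next
    fix p :: "(nat \<Rightarrow> real) \<Rightarrow> 'v" and n U m V \<phi>
    assume "p \<in> fine_diffeology n U" "smooth_euclidean_map m V n U \<phi>"
    then show "compose V p \<phi> \<in> fine_diffeology m V"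
      by (meson fineI fineD diffeology.plot_compose diffD)
  next
    fix \<U> n and p :: "(nat \<Rightarrow> real) \<Rightarrow> 'v"
    assume *: "\<And>U. U \<in> \<U> \<Longrightarrow> openin (Euclidean_space n) U" "p \<in> extensional (\<Union>\<U>)"
      "\<And>U. U \<in> \<U> \<Longrightarrow> restrict p U \<in> fine_diffeology n U"
    show "p \<in> fine_diffeology n (\<Union>\<U>)"
    proof (rule fineI)
      fix D :: "'v plots" assume D: "diffeological_vector_space D"
      show "p \<in> D n (\<Union>\<U>)"
        by (rule diffeology.plot_glue[OF diffD[OF D] *(1,2) fineD[OF D *(3)]])
    qed
  qed
  moreover have "diff_smooth (product_diffeology fine_diffeology fine_diffeology) fine_diffeology
      (\<lambda>(x, y). x + y :: 'v)"
    unfolding diff_smooth_def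
  proof (intro allI ballI fineI)
    fix n U and p :: "(nat \<Rightarrow> real) \<Rightarrow> 'v \<times> 'v" and D :: "'v plots"
    assume D: "diffeological_vector_space D"
      and "p \<in> product_diffeology fine_diffeology fine_diffeology n U"
    then have "p \<in> product_diffeology D D n U"
      using fineD[OF D] unfolding product_diffeology_def by blast
    with D show "compose U (\<lambda>(x, y). x + y) p \<in> D n U"
      unfolding diffeological_vector_space_def diff_smooth_def by blast
  qed
  moreover have "diff_smooth (product_diffeology real_diffeology fine_diffeology) fine_diffeology
      (\<lambda>(a, x). a *\<^sub>R x :: 'v)"
    unfolding diff_smooth_def
  proof (intro allI ballI fineI)
    fix n U and p :: "(nat \<Rightarrow> real) \<Rightarrow> real \<times> 'v" and D :: "'v plots"
    assume D: "diffeological_vector_space D"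
      and "p \<in> product_diffeology real_diffeology fine_diffeology n U"
    then have "p \<in> product_diffeology real_diffeology D n U"
      using fineD[OF D] unfolding product_diffeology_def by blast
    with D show "compose U (\<lambda>(a, x). a *\<^sub>R x) p \<in> D n U"
      unfolding diffeological_vector_space_def diff_smooth_def by blast
  qed
  ultimately show ?thesis
    unfolding diffeological_vector_space_def by blast
qed

end

theory Submission
  imports Defs
begin

text \<open>
  A linear surjection \<open>f\<close> of vector spaces has a linear right inverse \<open>s\<close>, so \<open>s \<circ> g\<close> is a linear
  lift of \<open>g\<close>; smoothness is automatic. Indeed, for a linear \<open>h : V \<rightarrow> W\<close> the pullback along \<open>h\<close> of
  the diffeology of \<open>W\<close> makes \<open>V\<close> a diffeological vector space, hence contains the fine diffeology,
  which says that \<open>h\<close> is smooth on the fine space \<open>V\<close>.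
\<close>

text \<open>\<open>compose U h p\<close> sees only the values of \<open>p\<close> on
  \<open>U\<close>, so extensionality of \<open>p\<close> is imposed separately; openness of
  \<open>U\<close> is inherited when \<open>D\<close> is a diffeology.\<close>

definition pullback_diffeology :: "('v \<Rightarrow> 'w) \<Rightarrow> 'w plots \<Rightarrow> 'v plots" where
  "pullback_diffeology h D n U = {p \<in> extensional U. compose U h p \<in> D n U}"

text \<open>Composing with \<open>h\<close> on the left commutes with reparametrisation and
  restriction and keeps constants constant, so each axiom is inherited from
  \<open>D\<close>.\<close>

lemma diffeology_pullback:
  assumes "diffeology D"
  shows "diffeology (pullback_diffeology h D)"
proof -
  interpret diffeology D by fact
  show ?thesis
  proof
    fix p n U assume "p \<in> pullback_diffeology h D n U"
    then show "openin (Euclidean_space n) U" "p \<in> extensional U"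
      using plot_open by (auto simp: pullback_diffeology_def)
  next
    fix n U c assume "openin (Euclidean_space n) U"
    moreover have "compose U h (\<lambda>_\<in>U. c) = (\<lambda>_\<in>U. h c)"
      by (auto simp: compose_def)
    ultimately show "(\<lambda>_\<in>U. c) \<in> pullback_diffeology h D n U"
      using plot_const by (simp add: pullback_diffeology_def)
  next
    fix p n U m V \<phi>
    assume p: "p \<in> pullback_diffeology h D n U" and \<phi>: "smooth_euclidean_map m V n U \<phi>"
    \<comment> \<open>This relies on \<phi> mapping \<open>V\<close> into \<open>U\<close>: off
      \<open>U\<close>, \<open>compose U h p\<close> is \<open>undefined\<close>.\<close>
    have "compose V h (compose V p \<phi>) = compose V (compose U h p) \<phi>"
      using \<phi> by (auto simp: compose_def smooth_euclidean_map_def fun_eq_iff)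
    with p plot_compose[OF _ \<phi>, of "compose U h p"]
    show "compose V p \<phi> \<in> pullback_diffeology h D m V"
      by (simp add: pullback_diffeology_def)
  next
    fix \<U> n p
    assume \<U>: "\<And>U. U \<in> \<U> \<Longrightarrow> openin (Euclidean_space n) U" and p: "p \<in> extensional (\<Union>\<U>)"
      and glue: "\<And>U. U \<in> \<U> \<Longrightarrow> restrict p U \<in> pullback_diffeology h D n U"
    have "restrict (compose (\<Union>\<U>) h p) U \<in> D n U" if "U \<in> \<U>" for U
    proof -
      have "restrict (compose (\<Union>\<U>) h p) U = compose U h (restrict p U)"
        using that by (auto simp: compose_def fun_eq_iff)
      with glue[OF that] show ?thesis by (simp add: pullback_diffeology_def)
    qed
    with \<U> have "compose (\<Union>\<U>) h p \<in> D n (\<Union>\<U>)"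
      by (intro plot_glue) auto
    with p show "p \<in> pullback_diffeology h D n (\<Union>\<U>)"
      by (simp add: pullback_diffeology_def)
  qed
qed

text \<open>Linearity says that \<open>h\<close> intertwines the operations of the two spaces, so
  smoothness of those on the target transfers to the source.\<close>

lemma diffeological_vector_space_pullback:
  assumes "diffeological_vector_space D" and "linear h"
  shows "diffeological_vector_space (pullback_diffeology h D)"
proof -
  have add: "diff_smooth (product_diffeology D D) D (\<lambda>(x, y). x + y)"
    and scale: "diff_smooth (product_diffeology real_diffeology D) D (\<lambda>(a, x). a *\<^sub>R x)"
    and "diffeology D"
    using assms(1) by (simp_all add: diffeological_vector_space_def)
  moreover have "diff_smooth (product_diffeology (pullback_diffeology h D) (pullback_diffeology h D))
      (pullback_diffeology h D) (\<lambda>(x, y). x + y)"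
    unfolding diff_smooth_def
  proof (intro allI ballI)
    fix n U p
    assume p: "p \<in> product_diffeology (pullback_diffeology h D) (pullback_diffeology h D) n U"
    \<comment> \<open>Applying \<open>h\<close> to both summands turns \<open>p\<close> into a plot
      of the product over \<open>D\<close>, where addition is known to be smooth.\<close>
    have "compose U fst (compose U (map_prod h h) p) = compose U h (compose U fst p)"
      "compose U snd (compose U (map_prod h h) p) = compose U h (compose U snd p)"
      by (auto simp: compose_def)
    with p have "compose U (map_prod h h) p \<in> product_diffeology D D n U"
      by (simp add: product_diffeology_def pullback_diffeology_def)
    with add have "compose U (\<lambda>(x, y). x + y) (compose U (map_prod h h) p) \<in> D n U"
      by (simp add: diff_smooth_def)
    moreover have "compose U (\<lambda>(x, y). x + y) (compose U (map_prod h h) p) =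
        compose U h (compose U (\<lambda>(x, y). x + y) p)"
      by (auto simp: compose_def fun_eq_iff case_prod_beta linear_add[OF assms(2)])
    ultimately show "compose U (\<lambda>(x, y). x + y) p \<in> pullback_diffeology h D n U"
      by (simp add: pullback_diffeology_def)
  qed
  moreover have "diff_smooth (product_diffeology real_diffeology (pullback_diffeology h D))
      (pullback_diffeology h D) (\<lambda>(a, x). a *\<^sub>R x)"
    unfolding diff_smooth_def
  proof (intro allI ballI)
    fix n U p
    assume p: "p \<in> product_diffeology real_diffeology (pullback_diffeology h D) n U"
    \<comment> \<open>Here only the vector is moved by \<open>h\<close>; the scalar keeps its
      standard diffeology.\<close>
    have "compose U fst (compose U (map_prod id h) p) = compose U fst p"
      "compose U snd (compose U (map_prod id h) p) = compose U h (compose U snd p)"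
      by (auto simp: compose_def)
    with p have "compose U (map_prod id h) p \<in> product_diffeology real_diffeology D n U"
      by (simp add: product_diffeology_def pullback_diffeology_def)
    with scale have "compose U (\<lambda>(a, x). a *\<^sub>R x) (compose U (map_prod id h) p) \<in> D n U"
      by (simp add: diff_smooth_def)
    moreover have "compose U (\<lambda>(a, x). a *\<^sub>R x) (compose U (map_prod id h) p) =
        compose U h (compose U (\<lambda>(a, x). a *\<^sub>R x) p)"
      by (auto simp: compose_def fun_eq_iff case_prod_beta linear_scale[OF assms(2)])
    ultimately show "compose U (\<lambda>(a, x). a *\<^sub>R x) p \<in> pullback_diffeology h D n U"
      by (simp add: pullback_diffeology_def)
  qed
  ultimately show ?thesis
    by (simp add: diffeological_vector_space_def diffeology_pullback)
qed

lemma diff_smooth_fine_linear: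
  assumes "diffeological_vector_space D" and "linear h"
  shows "diff_smooth fine_diffeology D h"
  using fine_diffeology_least[OF diffeological_vector_space_pullback[OF assms]]
  by (auto simp: diff_smooth_def pullback_diffeology_def)

theorem corollary6p3:
  fixes D :: "'v::real_vector plots"
  assumes "fine_diffeological_vector_space D"
  shows "projective_diffeological_vector_space TYPE('a::real_vector) TYPE('b::real_vector) D"
proof -
  have D: "D = fine_diffeology"
    using assms by (simp add: fine_diffeological_vector_space_def)
  have "\<exists>h. linear h \<and> diff_smooth D D1 h \<and> g = f \<circ> h"
    if "linear_subduction D1 D2 f" "linear g"
    for D1 :: "'a plots" and D2 :: "'b plots" and f g
  proof -
    have "diffeological_vector_space D1" "linear f" "surj f"
      using that(1) by (simp_all add: linear_subduction_def)
    \<comment> \<open>Such an \<open>s\<close> is found by choosing preimages of the vectors of a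
      Hamel basis. It may fail to be smooth for \<open>D2\<close>; only \<open>s \<circ> g\<close>,
      which starts at the fine space, has to be.\<close>
    then obtain s where s: "linear s" "f \<circ> s = id"
      using real_vector.linear_surj_right_inverse[of f UNIV UNIV]
      by (auto simp: fun_eq_iff)
    have "linear (s \<circ> g)"
      using \<open>linear g\<close> s(1) by (rule linear_compose)
    moreover have "g = f \<circ> (s \<circ> g)"
      by (simp add: s(2) flip: comp_assoc)
    ultimately show ?thesis
      using diff_smooth_fine_linear[OF \<open>diffeological_vector_space D1\<close>] D by blast
  qed
  \<comment> \<open>Projectivity also requires \<open>D\<close> itself to be a vector space
    diffeology.\<close>
  then show ?thesis
    unfolding projective_diffeological_vector_space_def
    using D diffeological_vector_space_fine by blast
qed

end
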